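(* Let $q,a,z\in]0,1[$. Then in the limit $q\to1^-$ the $q$-binomial identity $$\sum_{n\ge 0}\frac{\phi(aq^{n})}{\phi(q^{n+1})}z^n=\frac{\phi(a)\phi(z)}{\phi(q)\phi(az)}$$ leads to the Rogers pentagonal identity $$\mathrm{Li}_2(a)+\mathrm{Li}_2(z)=\mathrm{Li}_2(az)+\mathrm{Li}_2\left(\frac{a-az}{1-az}\right)+\mathrm{Li}_2\left(\frac{z-az}{1-az}\right)+\ln\left(\frac{1-z}{1-az}\right)\ln\left(\frac{1-a}{1-az}\right).$$
   Context: For $q,x\in]0,1[$, the $q$-exponential function is $\phi(x):=1/(x;q)_\infty:=1/\prod_{n\ge0}(1-q^nx)$ (it depends on $q$). The Euler dilogarithm function is $\mathrm{Li}_2(x):=\sum_{n=1}^\infty \frac{x^n}{n^2}$. Here $]0,1[$ denotes the open unit interval and $q\to1^-$ the limit from below. *)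

theory Defs
  imports "HOL-Analysis.Analysis"
begin

definition qexp :: "real \<Rightarrow> real \<Rightarrow> real" where
  "qexp q x = 1 / (\<Prod>n. 1 - q ^ n * x)"

(* The sum over n \<ge> 1 of x^n / n^2, shifted to start at 0; it also converges at x = 1. *)
definition Li2 :: "real \<Rightarrow> real" where
  "Li2 x = (\<Sum>n. x ^ Suc n / (real (Suc n))\<^sup>2)"

end

theory Submission
  imports Defs
begin

(* For 0 < q < 1 the functional equation F x = F (q x) / (1 - x), with F 0 = 1 and F continuous
   at 0, has qexp q as its only solution on [0, 1).  Applied to exp (\<Sum>k. x^k / (k (1 - q^k))) it
   yields the Lambert-type series for ln (qexp q x), and applied to a normalisation of the left-hand
   side, multiplied by qexp q (a z), it yields the q-binomial identity.  Multiplying the Lambert-type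
   series by 1 - q, Tannery's theorem gives the limit Li2.  The pentagonal identity
   holds because its two sides agree at z = 0 and have the same derivative in z. *)

section \<open>The functional equation of the q-exponential and the series for its logarithm\<close>

text \<open>Iterating the functional equation \<open>n\<close> times turns \<open>F x\<close> times
  the \<open>n\<close>-th partial product into \<open>F (q ^ n * x)\<close>, which tends to
  \<open>F 0 = 1\<close> by continuity. Convergence of the infinite product comes out of the same
  argument.\<close>

lemma qexp_unique:
  fixes q x :: real
  assumes q: "0 < q" "q < 1" and x: "0 \<le> x" "x < 1"
    and step: "\<And>y. 0 \<le> y \<Longrightarrow> y < 1 \<Longrightarrow> F y = F (q * y) / (1 - y)"
    and F0: "F 0 = 1" and cont: "isCont F 0"
  shows "F x = qexp q x"
proof -
  have le: "q ^ n * x \<le> x" for n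
    using q x by (intro mult_left_le_one_le) (auto simp: power_le_one)
  have partial: "(\<Prod>k<n. 1 - q ^ k * x) * F x = F (q ^ n * x)" for n
  proof (induction n)
    case (Suc n)
    have lt: "0 \<le> q ^ n * x" "q ^ n * x < 1"
      using q x le[of n] by auto
    have "(\<Prod>k<Suc n. 1 - q ^ k * x) * F x = (1 - q ^ n * x) * F (q ^ n * x)"
      using Suc by (simp add: mult_ac)
    also have "\<dots> = F (q ^ Suc n * x)"
      using step[OF lt] lt by (simp add: field_simps)
    finally show ?case .
  qed simp
  have "(\<lambda>n. q ^ n * x) \<longlonglongrightarrow> 0 * x"
    using q by (intro tendsto_intros LIMSEQ_realpow_zero) auto
  then have "(\<lambda>n. F (q ^ n * x)) \<longlonglongrightarrow> 1"
    using isCont_tendsto_compose[OF cont] F0 by fastforce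
  then have lim: "(\<lambda>n. (\<Prod>k<n. 1 - q ^ k * x) * F x) \<longlonglongrightarrow> 1"
    by (simp add: partial)
  \<comment> \<open>If \<open>F x\<close> were 0, the sequence in \<open>lim\<close> would be
    constantly 0 and yet tend to 1.\<close>
  have nz: "F x \<noteq> 0"
    using lim LIMSEQ_unique[of "\<lambda>_. 0::real" 0 1] by (auto simp: tendsto_const)
  have "(\<lambda>n. (\<Prod>k<n. 1 - q ^ k * x) * F x / F x) \<longlonglongrightarrow> 1 / F x"
    using lim nz by (intro tendsto_intros) auto
  then have "(\<lambda>n. \<Prod>k<n. 1 - q ^ k * x) \<longlonglongrightarrow> 1 / F x"
    using nz by simp
  \<comment> \<open>\<open>raw_has_prod\<close> is stated with products over \<open>{..n}\<close>,
    hence the index shift; it also asks for a nonzero limit.\<close>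
  then have "(\<lambda>n. \<Prod>k\<le>n. 1 - q ^ k * x) \<longlonglongrightarrow> 1 / F x"
    by (subst (asm) filterlim_sequentially_Suc[symmetric]) (simp only: lessThan_Suc_atMost)
  then have "(\<lambda>n. 1 - q ^ n * x) has_prod (1 / F x)"
    using nz by (simp add: has_prod_def raw_has_prod_def)
  then show ?thesis
    unfolding qexp_def by (metis has_prod_unique div_by_1 divide_divide_eq_right mult_1)
qed

(* The k = 0 term is 1 / 0 = 0. *)
definition qexp_log :: "real \<Rightarrow> real \<Rightarrow> real" where
  "qexp_log q x = (\<Sum>k. 1 / (real k * (1 - q ^ k)) * x ^ k)"

text \<open>For \<open>k\<close> at least 1, both \<open>k \<ge> 1\<close> and
  \<open>1 - q ^ k \<ge> 1 - q\<close>. A bound uniform in \<open>k\<close> is enough to compare the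
  series with a geometric one on the open unit interval.\<close>

lemma qexp_log_coeff_bound:
  fixes q :: real
  assumes "0 < q" "q < 1"
  shows "\<bar>1 / (real k * (1 - q ^ k))\<bar> \<le> 1 / (1 - q)"
proof (cases "k = 0")
  case False
  have "q ^ k \<le> q ^ 1"
    using assms False by (intro power_decreasing) auto
  then have "1 * (1 - q) \<le> real k * (1 - q ^ k)"
    using assms False by (intro mult_mono) auto
  then show ?thesis
    using assms by (auto simp: abs_if intro!: divide_left_mono)
qed (use assms in auto)

lemma summable_qexp_log:
  fixes q x :: real
  assumes "0 < q" "q < 1" "\<bar>x\<bar> < 1"
  shows "summable (\<lambda>k. 1 / (real k * (1 - q ^ k)) * x ^ k)"
proof (rule summable_comparison_test')
  show "summable (\<lambda>k. 1 / (1 - q) * \<bar>x\<bar> ^ k)"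
    using assms by (intro summable_mult summable_geometric) auto
  show "norm (1 / (real k * (1 - q ^ k)) * x ^ k) \<le> 1 / (1 - q) * \<bar>x\<bar> ^ k" if "0 \<le> k" for k
    unfolding norm_mult norm_power unfolding real_norm_def
    using qexp_log_coeff_bound[OF assms(1,2)] by (intro mult_right_mono) auto
qed

lemma isCont_qexp_log:
  fixes q x :: real
  assumes "0 < q" "q < 1" "\<bar>x\<bar> < 1"
  shows "isCont (qexp_log q) x"
proof -
  obtain r where r: "\<bar>x\<bar> < r" "r < 1"
    using assms dense by blast
  have "summable (\<lambda>k. 1 / (real k * (1 - q ^ k)) * r ^ k)"
    using assms r by (intro summable_qexp_log) auto
  then show ?thesis
    unfolding qexp_log_def[abs_def] by (rule isCont_powser) (use r in auto)
qed

text \<open>The Mercator series can start at index 0 because its term there is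
  \<open>1 / 0 = 0\<close>.\<close>

lemma minus_ln_one_minus_sums:
  fixes x :: real
  assumes "\<bar>x\<bar> < 1"
  shows "(\<lambda>n. x ^ n / real n) sums (- ln (1 - x))"
  using sums_minus[OF ln_series'[of "- x"]] assms by simp

text \<open>Replacing \<open>x\<close> by \<open>q * x\<close> multiplies the \<open>k\<close>-th
  term by \<open>q ^ k\<close>, so the difference cancels the factor \<open>1 - q ^ k\<close> and
  leaves the Mercator series.\<close>

lemma qexp_log_step:
  fixes q x :: real
  assumes "0 < q" "q < 1" "0 \<le> x" "x < 1"
  shows "qexp_log q x = qexp_log q (q * x) - ln (1 - x)"
proof -
  have "q * x \<le> x"
    using assms by (simp add: mult_left_le_one_le)
  then have qx: "\<bar>q * x\<bar> < 1"
    using assms by (simp add: abs_mult)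
  have "qexp_log q x - qexp_log q (q * x) =
      (\<Sum>k. 1 / (real k * (1 - q ^ k)) * x ^ k - 1 / (real k * (1 - q ^ k)) * (q * x) ^ k)"
    unfolding qexp_log_def using assms qx by (intro suminf_diff summable_qexp_log) auto
  also have "\<dots> = (\<Sum>k. x ^ k / real k)"
  proof (rule suminf_cong)
    fix k
    show "1 / (real k * (1 - q ^ k)) * x ^ k - 1 / (real k * (1 - q ^ k)) * (q * x) ^ k
        = x ^ k / real k"
    proof (cases "k = 0")
      case False
      then have "q ^ k < 1"
        using assms by (simp add: power_less_one_iff)
      then show ?thesis
        using False by (simp add: power_mult_distrib divide_simps) (simp add: algebra_simps)
    qed simp
  qed
  also have "\<dots> = - ln (1 - x)"
    using minus_ln_one_minus_sums[of x] assms by (simp add: sums_iff)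
  finally show ?thesis by simp
qed

text \<open>This trades the infinite product for a power series, from which positivity, the
  functional equation and the limit at 0 of \<open>qexp q\<close> are then read off.\<close>

lemma qexp_eq_exp:
  fixes q x :: real
  assumes "0 < q" "q < 1" "0 \<le> x" "x < 1"
  shows "qexp q x = exp (qexp_log q x)"
proof -
  have "exp (qexp_log q x) = qexp q x"
  proof (rule qexp_unique[OF assms])
    show "exp (qexp_log q y) = exp (qexp_log q (q * y)) / (1 - y)" if "0 \<le> y" "y < 1" for y
      using qexp_log_step[OF assms(1,2) that] that by (simp add: exp_diff)
    have "qexp_log q 0 = 1 / (real 0 * (1 - q ^ 0))"
      unfolding qexp_log_def by (rule powser_zero)
    then show "exp (qexp_log q 0) = 1"
      by simp
    show "isCont (\<lambda>x. exp (qexp_log q x)) 0"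
      by (intro isCont_o2[OF isCont_qexp_log isCont_exp]) (use assms in auto)
  qed
  then show ?thesis ..
qed

lemma qexp_pos:
  fixes q x :: real
  assumes "0 < q" "q < 1" "0 \<le> x" "x < 1"
  shows "qexp q x > 0"
  using qexp_eq_exp[OF assms] by simp

lemma qexp_0: "qexp q 0 = 1"
  by (simp add: qexp_def)

lemma qexp_step:
  fixes q x :: real
  assumes "0 < q" "q < 1" "0 \<le> x" "x < 1"
  shows "qexp q x = qexp q (q * x) / (1 - x)"
proof -
  have "q * x \<le> x"
    using assms by (simp add: mult_left_le_one_le)
  then show ?thesis
    using assms qexp_log_step[OF assms] by (simp add: qexp_eq_exp exp_diff)
qed

lemma tendsto_qexp_0:
  fixes q :: real
  assumes "0 < q" "q < 1" and "(f \<longlongrightarrow> 0) F" and "eventually (\<lambda>n. 0 \<le> f n \<and> f n < 1) F"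
  shows "((\<lambda>n. qexp q (f n)) \<longlongrightarrow> 1) F"
proof -
  have "isCont (\<lambda>x. exp (qexp_log q x)) 0"
    by (intro isCont_o2[OF isCont_qexp_log isCont_exp]) (use assms in auto)
  then have "((\<lambda>n. exp (qexp_log q (f n))) \<longlongrightarrow> exp (qexp_log q 0)) F"
    using assms(3) by (rule isCont_tendsto_compose)
  moreover have "exp (qexp_log q 0) = 1"
    using qexp_eq_exp[of q 0] assms by (simp add: qexp_0)
  moreover have "eventually (\<lambda>n. exp (qexp_log q (f n)) = qexp q (f n)) F"
    using assms(4) by eventually_elim (use assms in \<open>simp add: qexp_eq_exp\<close>)
  ultimately show ?thesis
    using Lim_transform_eventually by fastforce
qed

section \<open>The q-binomial identity\<close>

text \<open>The recurrence of the coefficients \<open>t n\<close> gives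
  \<open>(1 - y) * F y = (1 - a * y) * F (q * y)\<close> for their generating function
  \<open>F\<close>. Multiplying \<open>F y\<close> by the q-exponential at \<open>a * y\<close>
  absorbs the factor \<open>1 - a * y\<close>, and dividing by \<open>t 0\<close> normalises the
  value at 0, so \<open>qexp_unique\<close> applies.\<close>

lemma q_binomial:
  fixes q a z :: real
  assumes q: "0 < q" "q < 1" and a: "0 < a" "a < 1" and z: "0 \<le> z" "z < 1"
  shows "(\<lambda>n. qexp q (a * q ^ n) / qexp q (q ^ (n + 1)) * z ^ n)
           sums (qexp q a * qexp q z / (qexp q q * qexp q (a * z)))"
proof -
  define t where "t n = qexp q (a * q ^ n) / qexp q (q ^ (n + 1))" for n
  have qn: "0 < q ^ n" "q ^ n \<le> 1" "q ^ Suc n < 1" for n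
    using q power_Suc_less_one[of q n] by (auto simp: power_le_one)
  have aq: "0 \<le> a * q ^ n" "a * q ^ n < 1" for n
  proof -
    have "a * q ^ n \<le> a * 1"
      using a qn(2) by (intro mult_left_mono) auto
    then show "0 \<le> a * q ^ n" "a * q ^ n < 1"
      using a qn(1)[of n] by (simp, linarith)
  qed
  have tpos: "t n > 0" for n
    unfolding t_def using qexp_pos[OF q aq] qexp_pos[OF q _ qn(3)] qn(1)[of "Suc n"] by simp
  have rec: "t (Suc n) * (1 - q ^ Suc n) = t n * (1 - a * q ^ n)" for n
  proof -
    have 1: "qexp q (a * q ^ n) = qexp q (a * q ^ Suc n) / (1 - a * q ^ n)"
      using qexp_step[OF q aq[of n]] by (simp add: mult_ac)
    have 2: "qexp q (q ^ (n + 1)) = qexp q (q ^ (Suc n + 1)) / (1 - q ^ Suc n)"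
      using qexp_step[OF q less_imp_le[OF qn(1)] qn(3)[of n]] by simp
    show ?thesis
      unfolding t_def 1 2 using aq[of n] qn(3)[of n] by simp
  qed
  have qlim: "(\<lambda>n. q ^ n) \<longlonglongrightarrow> 0"
    using q by (intro LIMSEQ_realpow_zero) auto
  \<comment> \<open>Numerator and denominator of \<open>t n\<close> both tend to 1. Hence
    \<open>t\<close> is bounded, and a geometric series dominates the generating function.\<close>
  have "(\<lambda>n. qexp q (a * q ^ n)) \<longlonglongrightarrow> 1"
    using tendsto_mult_left[OF qlim, of a] aq by (intro tendsto_qexp_0[OF q]) auto
  moreover have "(\<lambda>n. qexp q (q ^ (n + 1))) \<longlonglongrightarrow> 1"
    using LIMSEQ_ignore_initial_segment[OF qlim, of 1] qn(3) q
    by (intro tendsto_qexp_0[OF q] always_eventually allI conjI) simp_all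
  ultimately have "t \<longlonglongrightarrow> 1 / 1"
    unfolding t_def[abs_def] by (intro tendsto_divide) auto
  then have "Bseq t"
    using convergent_imp_Bseq convergentI by blast
  then obtain M where M: "\<And>n. norm (t n) \<le> M"
    by (auto simp: Bseq_def)
  have summ: "summable (\<lambda>n. t n * y ^ n)" if "\<bar>y\<bar> < 1" for y
  proof -
    have "summable (\<lambda>n. M * \<bar>y\<bar> ^ n)"
      using that by (intro summable_mult summable_geometric) auto
    then show ?thesis
    proof (rule summable_comparison_test')
      show "norm (t n * y ^ n) \<le> M * \<bar>y\<bar> ^ n" if "0 \<le> n" for n
        using M[of n] by (simp add: abs_mult power_abs mult_right_mono)
    qed
  qed
  define F where "F y = (\<Sum>n. t n * y ^ n)" for y
  have contF: "isCont F 0"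
    \<comment> \<open>Any radius strictly between 0 and 1 serves here.\<close>
    unfolding F_def[abs_def] by (rule isCont_powser[OF summ[of "1/2"]]) auto
  have F0: "F 0 = t 0"
    unfolding F_def by (rule powser_zero)
  have step: "(1 - y) * F y = (1 - a * y) * F (q * y)" if y: "0 \<le> y" "y < 1" for y
  proof -
    have "q * y \<le> y"
      using q y by (simp add: mult_left_le_one_le)
    then have sy: "summable (\<lambda>n. t n * y ^ n)" and sqy: "summable (\<lambda>n. t n * (q * y) ^ n)"
      using q y by (auto intro!: summ simp: abs_mult)
    have "F y - F (q * y) = (\<Sum>n. t n * y ^ n - t n * (q * y) ^ n)"
      unfolding F_def by (rule suminf_diff[OF sy sqy])
    \<comment> \<open>The terms at \<open>n = 0\<close> cancel, since both equal \<open>t 0\<close>;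
      after the shift, \<open>rec\<close> applies termwise.\<close>
    also have "\<dots> = (\<Sum>n. t (Suc n) * y ^ Suc n - t (Suc n) * (q * y) ^ Suc n)"
      using suminf_split_head[OF summable_diff[OF sy sqy]] by simp
    also have "\<dots> = (\<Sum>n. y * (t n * y ^ n - a * (t n * (q * y) ^ n)))"
    proof (rule suminf_cong)
      fix n
      have "t (Suc n) * y ^ Suc n - t (Suc n) * (q * y) ^ Suc n
          = (t (Suc n) * (1 - q ^ Suc n)) * y ^ Suc n"
        by (simp add: power_mult_distrib algebra_simps)
      also have "\<dots> = y * (t n * y ^ n - a * (t n * (q * y) ^ n))"
        unfolding rec by (simp add: power_mult_distrib algebra_simps)
      finally show "t (Suc n) * y ^ Suc n - t (Suc n) * (q * y) ^ Suc n
          = y * (t n * y ^ n - a * (t n * (q * y) ^ n))" .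
    qed
    also have "\<dots> = y * (F y - a * F (q * y))"
      unfolding F_def using sy sqy
      by (simp add: suminf_mult suminf_diff[symmetric] summable_mult summable_diff)
    finally show ?thesis
      by (simp add: algebra_simps)
  qed
  have ay: "0 \<le> a * y" "a * y < 1" if "0 \<le> y" "y < 1" for y
    using a that mult_left_le_one_le[of y a] by auto
  \<comment> \<open>The q-exponential at \<open>a * z\<close> is written through its series because
    \<open>qexp_unique\<close> asks for two-sided continuity at 0, and
    \<open>isCont_qexp_log\<close> covers negative arguments as well.\<close>
  have "F z * exp (qexp_log q (a * z)) / t 0 = qexp q z"
  proof (rule qexp_unique[OF q z])
    show "F 0 * exp (qexp_log q (a * 0)) / t 0 = 1"
      using F0 tpos[of 0] q by (simp add: qexp_eq_exp[symmetric] qexp_0)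
    show "isCont (\<lambda>y. F y * exp (qexp_log q (a * y)) / t 0) 0"
      using tpos[of 0] q
      by (intro continuous_intros contF isCont_o2[OF _ isCont_qexp_log]) auto
    fix y :: real
    assume y: "0 \<le> y" "y < 1"
    have "F y = (1 - a * y) * F (q * y) / (1 - y)"
      using step[OF y] y by (simp add: field_simps)
    moreover have "exp (qexp_log q (a * y)) = exp (qexp_log q (a * (q * y))) / (1 - a * y)"
      using qexp_log_step[OF q ay[OF y]] ay[OF y] by (simp add: exp_diff mult_ac)
    ultimately show "F y * exp (qexp_log q (a * y)) / t 0
        = F (q * y) * exp (qexp_log q (a * (q * y))) / t 0 / (1 - y)"
      using ay[OF y] by simp
  qed
  then have "F z * qexp q (a * z) / t 0 = qexp q z"
    by (simp add: qexp_eq_exp[OF q ay[OF z]])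
  then have "F z = t 0 * qexp q z / qexp q (a * z)"
    using tpos[of 0] qexp_pos[OF q ay[OF z]] by (simp add: field_simps)
  also have "\<dots> = qexp q a * qexp q z / (qexp q q * qexp q (a * z))"
    by (simp add: t_def)
  finally show ?thesis
    using summable_sums[OF summ[of z]] z unfolding F_def t_def by simp
qed

section \<open>The dilogarithm as the limit of the scaled logarithm of the q-exponential\<close>

lemma summable_inverse_square: "summable (\<lambda>n. 1 / (real n)\<^sup>2)"
  using inverse_power_summable[of 2, where 'a = real] by (simp add: inverse_eq_divide)

lemma Li2_summable:
  fixes x :: real
  assumes "\<bar>x\<bar> \<le> 1"
  shows "summable (\<lambda>n. 1 / (real n)\<^sup>2 * x ^ n)"
proof (rule summable_comparison_test'[OF summable_inverse_square])
  show "norm (1 / (real n)\<^sup>2 * x ^ n) \<le> 1 / (real n)\<^sup>2" if "0 \<le> n" for n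
    using assms by (simp add: abs_mult power_abs power_le_one divide_right_mono)
qed

text \<open>Undoes the index shift in \<open>Li2\<close>: the added term at \<open>n = 0\<close> is
  \<open>1 / 0 = 0\<close>. In this form the series matches \<open>qexp_log\<close> term by
  term.\<close>

lemma Li2_eq_powser:
  fixes x :: real
  assumes "\<bar>x\<bar> \<le> 1"
  shows "Li2 x = (\<Sum>n. 1 / (real n)\<^sup>2 * x ^ n)"
  using suminf_split_head[OF Li2_summable[OF assms]] by (simp add: Li2_def)

lemma Li2_0: "Li2 0 = 0"
  by (simp add: Li2_def)

(* x \<le> q makes 1 / k^2 a majorant, since 1 - q^k = (1 - q) (1 + ... + q^(k-1)) \<ge> (1 - q) k q^(k-1). *)
lemma Lambert_term_bound:
  fixes q x :: real
  assumes "0 < q" "q < 1" "0 \<le> x" "x \<le> q"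
  shows "\<bar>(1 - q) * (1 / (real k * (1 - q ^ k)) * x ^ k)\<bar> \<le> 1 / (real k)\<^sup>2"
proof (cases k)
  case (Suc m)
  have "q ^ k < 1"
    using assms Suc by (simp add: power_Suc_less_one del: power_Suc)
  \<comment> \<open>Each summand of the geometric sum is bounded below by \<open>q ^ k\<close>, the
    same power that bounds \<open>x ^ k\<close> from above, so the quotient formed later is at most
    1.\<close>
  have "real k * q ^ k = (\<Sum>i<k. q ^ k)"
    by simp
  also have "\<dots> \<le> (\<Sum>i<k. q ^ i)"
    using assms by (intro sum_mono power_decreasing) auto
  finally have "(1 - q) * (real k * q ^ k) \<le> (1 - q) * (\<Sum>i<k. q ^ i)"
    using assms by (intro mult_left_mono) auto
  also have "\<dots> = 1 - q ^ k"
    by (simp add: one_diff_power_eq)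
  finally have *: "(1 - q) * (real k * q ^ k) \<le> 1 - q ^ k" .
  have "(1 - q) * (1 / (real k * (1 - q ^ k)) * x ^ k) \<le> (1 - q) * (1 / (real k * (1 - q ^ k)) * q ^ k)"
    using assms \<open>q ^ k < 1\<close> by (intro mult_left_mono power_mono) auto
  also have "\<dots> = (1 - q) * (real k * q ^ k) / (1 - q ^ k) / (real k)\<^sup>2"
    using Suc \<open>q ^ k < 1\<close> by (simp add: power2_eq_square)
  also have "\<dots> \<le> 1 / (real k)\<^sup>2"
    using * \<open>q ^ k < 1\<close> by (intro divide_right_mono) auto
  finally show ?thesis
    using assms \<open>q ^ k < 1\<close> by (subst abs_of_nonneg) auto
qed simp

text \<open>The factor \<open>1 - q\<close> cancels from \<open>1 - q ^ k\<close>, leaving a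
  geometric sum of \<open>k\<close> terms that tends to \<open>k\<close>. At \<open>k = 0\<close>
  both sides are 0.\<close>

lemma tendsto_Lambert_coeff:
  "((\<lambda>q::real. (1 - q) * (1 / (real k * (1 - q ^ k)))) \<longlongrightarrow> 1 / (real k)\<^sup>2) (at_left 1)"
proof (cases "k = 0")
  case False
  have "((\<lambda>q::real. 1 / (real k * (\<Sum>i<k. q ^ i))) \<longlongrightarrow> 1 / (real k * (\<Sum>i<k. 1 ^ i))) (at_left 1)"
    using False by (intro tendsto_intros) auto
  moreover have "eventually (\<lambda>q::real. q < 1) (at_left 1)"
    by (simp add: eventually_at_filter)
  then have "eventually (\<lambda>q::real. 1 / (real k * (\<Sum>i<k. q ^ i))
      = (1 - q) * (1 / (real k * (1 - q ^ k)))) (at_left 1)"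
    by eventually_elim (simp add: one_diff_power_eq)
  ultimately show ?thesis
    by (auto simp: power2_eq_square intro: Lim_transform_eventually)
qed simp

text \<open>The argument \<open>f q\<close> may move with \<open>q\<close> so that one statement
  covers constants and also \<open>f q = q\<close>, where the limit is \<open>Li2 1\<close>. The
  condition \<open>f q \<le> q\<close> supplies a majorant independent of \<open>q\<close> for
  Tannery's theorem.\<close>

lemma tendsto_ln_qexp:
  fixes f :: "real \<Rightarrow> real"
  assumes lim: "(f \<longlongrightarrow> l) (at_left 1)"
    and ev: "eventually (\<lambda>q. 0 \<le> f q \<and> f q \<le> q) (at_left 1)" and l: "\<bar>l\<bar> \<le> 1"
  shows "((\<lambda>q. (1 - q) * ln (qexp q (f q))) \<longlongrightarrow> Li2 l) (at_left 1)"
proof -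
  have "eventually (\<lambda>q::real. q \<in> {0<..<1}) (at_left 1)"
    by (rule eventually_at_left_real) simp
  then have ev': "eventually (\<lambda>q. 0 < q \<and> q < 1 \<and> 0 \<le> f q \<and> f q \<le> q) (at_left 1)"
    using ev by eventually_elim auto
  define A where "A k q = (1 - q) * (1 / (real k * (1 - q ^ k)) * f q ^ k)" for k q
  have "eventually (\<lambda>q. \<forall>k. norm (A k q) \<le> 1 / (real k)\<^sup>2) (at_left 1)"
    using ev' by eventually_elim (unfold A_def real_norm_def, intro allI Lambert_term_bound, auto)
  \<comment> \<open>The bound holds for all \<open>k\<close>, so the always true predicate serves in
    the first component of the product filter.\<close>
  then have bound: "eventually (\<lambda>(k, q). norm (A k q) \<le> 1 / (real k)\<^sup>2) (at_top \<times>\<^sub>F at_left 1)"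
    unfolding eventually_prod_filter by (intro exI[of _ "\<lambda>_. True"] exI conjI) auto
  have "((\<lambda>q. A k q) \<longlongrightarrow> 1 / (real k)\<^sup>2 * l ^ k) (at_left 1)" for k
    unfolding A_def mult.assoc[symmetric]
    by (intro tendsto_mult tendsto_power lim) (simp add: tendsto_Lambert_coeff[simplified])
  then have "((\<lambda>q. \<Sum>k. A k q) \<longlongrightarrow> (\<Sum>k. 1 / (real k)\<^sup>2 * l ^ k)) (at_left 1)"
    using tannerys_theorem[OF _ bound summable_inverse_square] by simp
  then have "((\<lambda>q. \<Sum>k. A k q) \<longlongrightarrow> Li2 l) (at_left 1)"
    by (simp only: Li2_eq_powser[OF l])
  moreover have "eventually (\<lambda>q. (\<Sum>k. A k q) = (1 - q) * ln (qexp q (f q))) (at_left 1)"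
    using ev'
  proof eventually_elim
    case (elim q)
    then have "(\<Sum>k. A k q) = (1 - q) * qexp_log q (f q)"
      unfolding A_def qexp_log_def by (intro suminf_mult summable_qexp_log) auto
    also have "\<dots> = (1 - q) * ln (qexp q (f q))"
      using elim by (simp add: qexp_eq_exp)
    finally show ?case .
  qed
  ultimately show ?thesis
    by (rule Lim_transform_eventually)
qed

section \<open>The derivative of the dilogarithm and the Rogers identity\<close>

text \<open>Termwise differentiation yields the Mercator series after multiplication by
  \<open>x\<close>. The product form is chosen to include \<open>x = 0\<close>, where the derivative
  is 1 but the quotient \<open>- ln (1 - x) / x\<close> evaluates to 0.\<close>

lemma Li2_has_derivative:
  fixes x :: real
  assumes "\<bar>x\<bar> < 1"
  shows "\<exists>D. (Li2 has_real_derivative D) (at x) \<and> x * D = - ln (1 - x)"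
proof -
  define c :: "nat \<Rightarrow> real" where "c n = 1 / (real n)\<^sup>2" for n
  define D where "D = (\<Sum>n. diffs c n * x ^ n)"
  have summ: "summable (\<lambda>n. c n * y ^ n)" if "\<bar>y\<bar> \<le> 1" for y
    using Li2_summable[OF that] by (simp add: c_def)
  have "((\<lambda>y. \<Sum>n. c n * y ^ n) has_real_derivative D) (at x)"
    \<comment> \<open>The series converges at the endpoint 1, which allows differentiation wherever
      \<open>\<bar>x\<bar> < 1\<close>.\<close>
    unfolding D_def by (rule termdiffs_strong[OF summ[of 1]]) (use assms in auto)
  moreover have "eventually (\<lambda>y. y \<in> {-1<..<1}) (nhds x)"
    using assms by (intro eventually_nhds_in_open) auto
  then have "eventually (\<lambda>y. (\<Sum>n. c n * y ^ n) = Li2 y) (nhds x)"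
    by eventually_elim (use Li2_eq_powser in \<open>auto simp: c_def\<close>)
  ultimately have "(Li2 has_real_derivative D) (at x)"
    by (simp only: DERIV_cong_ev[OF refl _ refl])
  moreover have "x * D = - ln (1 - x)"
  proof -
    have S: "summable (\<lambda>n. x ^ n / real n)" "(\<Sum>n. x ^ n / real n) = - ln (1 - x)"
      using minus_ln_one_minus_sums[OF assms] by (auto simp: sums_iff)
    have "summable (\<lambda>n. diffs c n * x ^ n)"
      by (rule termdiff_converges[of x 1]) (use assms in \<open>auto intro!: summ\<close>)
    then have "x * D = (\<Sum>n. x * (diffs c n * x ^ n))"
      unfolding D_def by (simp add: suminf_mult)
    also have "\<dots> = (\<Sum>n. x ^ Suc n / real (Suc n))"
      by (intro suminf_cong) (simp add: diffs_def c_def power2_eq_square)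
    also have "\<dots> = - ln (1 - x)"
      using suminf_split_head[OF S(1)] S(2) by simp
    finally show ?thesis .
  qed
  ultimately show ?thesis by blast
qed

lemma Li2_DERIV:
  fixes x :: real
  assumes "\<bar>x\<bar> < 1" "x \<noteq> 0"
  shows "(Li2 has_real_derivative (- ln (1 - x) / x)) (at x)"
proof -
  obtain D where D: "(Li2 has_real_derivative D) (at x)" "x * D = - ln (1 - x)"
    using Li2_has_derivative[OF assms(1)] by blast
  then have "D = - ln (1 - x) / x"
    using assms by (simp add: field_simps)
  with D show ?thesis by simp
qed

lemma isCont_Li2: "\<bar>x\<bar> < 1 \<Longrightarrow> isCont Li2 x"
  using Li2_has_derivative DERIV_isCont by blast

lemma Rogers_pentagonal:
  fixes a z :: real
  assumes a: "0 < a" "a < 1" and z: "0 < z" "z < 1"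
  shows "Li2 a + Li2 z
           = Li2 (a * z) + Li2 ((a - a * z) / (1 - a * z)) + Li2 ((z - a * z) / (1 - a * z))
             + ln ((1 - z) / (1 - a * z)) * ln ((1 - a) / (1 - a * z))"
proof -
  define u where "u t = (a - a * t) / (1 - a * t)" for t
  define v where "v t = (t - a * t) / (1 - a * t)" for t
  \<comment> \<open>The difference of the two sides as a function of \<open>t\<close> in place of
    \<open>z\<close>, without the constant \<open>Li2 a\<close> and with the logarithms of quotients
    split.\<close>
  define g where "g t = Li2 t - Li2 (a * t) - Li2 (u t) - Li2 (v t)
    - (ln (1 - t) - ln (1 - a * t)) * (ln (1 - a) - ln (1 - a * t))" for t
  have at: "0 \<le> a * t" "a * t \<le> t" "a * t < 1" if "0 \<le> t" "t < 1" for t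
    using a that mult_left_le_one_le[of t a] by auto
  have uv: "0 < u t" "u t < 1" "0 \<le> v t" "v t < 1" "1 - u t = (1 - a) / (1 - a * t)"
      "1 - v t = (1 - t) / (1 - a * t)" if t: "0 \<le> t" "t < 1" for t
  proof -
    have "a * t < a"
      using a t by simp
    then show "0 < u t" "u t < 1" "0 \<le> v t" "v t < 1"
      using a t at[OF t] by (simp_all add: u_def v_def)
    show "1 - u t = (1 - a) / (1 - a * t)" "1 - v t = (1 - t) / (1 - a * t)"
      using at[OF t] by (simp_all add: u_def v_def field_simps)
  qed
  have "g z = g 0"
  proof (rule DERIV_isconst_end[OF z(1)])
    show "continuous_on {0..z} g"
    proof (intro continuous_at_imp_continuous_on ballI)
      fix t assume "t \<in> {0..z}"
      then have t: "0 \<le> t" "t < 1"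
        using z by auto
      show "isCont g t"
        unfolding g_def
        using t a at[OF t] uv[OF t]
        by (intro continuous_intros isCont_o2[OF _ isCont_Li2]) (auto simp: u_def v_def)
    qed
    fix t assume "0 < t" "t < z"
    then have t: "0 \<le> t" "t < 1" "0 < t"
      using z by auto
    \<comment> \<open>The two factors of the logarithmic product are \<open>ln (1 - v t)\<close> and
      \<open>ln (1 - u t)\<close>, which are also the logarithms in the derivative of
      \<open>Li2\<close> at \<open>v t\<close> and \<open>u t\<close>. This is why the terms
      cancel.\<close>
    define P where "P = ln (1 - t) - ln (1 - a * t)"
    define Q where "Q = ln (1 - a) - ln (1 - a * t)"
    have P: "ln (1 - v t) = P" and Q: "ln (1 - u t) = Q"
      using uv[OF t(1,2)] at[OF t(1,2)] a t by (simp_all add: P_def Q_def ln_div)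
    have d1: "(Li2 has_real_derivative (- ln (1 - t) / t)) (at t)"
      by (rule Li2_DERIV) (use t in auto)
    have "(Li2 has_real_derivative (- ln (1 - a * t) / (a * t))) (at (a * t))"
      by (rule Li2_DERIV) (use t a at[OF t(1,2)] in auto)
    then have d2: "((\<lambda>t. Li2 (a * t)) has_real_derivative (- ln (1 - a * t) / (a * t) * a)) (at t)"
      by (rule DERIV_chain2) (auto intro!: derivative_eq_intros)
    \<comment> \<open>Written as \<open>u t\<close> times a logarithmic derivative, so that
      \<open>u t\<close> cancels against the denominator from \<open>Li2_DERIV\<close>; likewise for
      \<open>v\<close>.\<close>
    have u': "(u has_real_derivative (u t * (a / (1 - a * t) - 1 / (1 - t)))) (at t)"
      unfolding u_def using t at[OF t(1,2)]
      by (auto intro!: derivative_eq_intros simp: divide_simps) (simp add: algebra_simps)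
    have v': "(v has_real_derivative (v t * (1 / t + a / (1 - a * t)))) (at t)"
      unfolding v_def using t at[OF t(1,2)]
      by (auto intro!: derivative_eq_intros simp: divide_simps) (simp add: algebra_simps)
    have vpos: "0 < v t"
      unfolding v_def using t a at[OF t(1,2)] by simp
    have "(Li2 has_real_derivative (- Q / u t)) (at (u t))"
      unfolding Q[symmetric] by (rule Li2_DERIV) (use uv[OF t(1,2)] in auto)
    from DERIV_chain2[OF this u']
    have d3: "((\<lambda>t. Li2 (u t)) has_real_derivative (- Q * (a / (1 - a * t) - 1 / (1 - t)))) (at t)"
      using uv[OF t(1,2)] by simp
    have "(Li2 has_real_derivative (- P / v t)) (at (v t))"
      unfolding P[symmetric] by (rule Li2_DERIV) (use uv[OF t(1,2)] vpos in auto)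
    from DERIV_chain2[OF this v']
    have d4: "((\<lambda>t. Li2 (v t)) has_real_derivative (- P * (1 / t + a / (1 - a * t)))) (at t)"
      using vpos by simp
    have d5: "((\<lambda>t. (ln (1 - t) - ln (1 - a * t)) * (ln (1 - a) - ln (1 - a * t)))
        has_real_derivative ((a / (1 - a * t) - 1 / (1 - t)) * Q + P * (a / (1 - a * t)))) (at t)"
      unfolding P_def Q_def using t a at[OF t(1,2)]
      by (auto intro!: derivative_eq_intros simp: algebra_simps)
    have "(g has_real_derivative
        (- ln (1 - t) / t - (- ln (1 - a * t) / (a * t) * a)
          - (- Q * (a / (1 - a * t) - 1 / (1 - t))) - (- P * (1 / t + a / (1 - a * t)))
          - ((a / (1 - a * t) - 1 / (1 - t)) * Q + P * (a / (1 - a * t))))) (at t)"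
      unfolding g_def by (intro DERIV_diff d1 d2 d3 d4 d5)
    \<comment> \<open>This is what remains after the terms with \<open>Q\<close> and with
      \<open>P * (a / (1 - a * t))\<close> have cancelled.\<close>
    moreover have "- ln (1 - t) / t - (- ln (1 - a * t) / (a * t) * a) + P / t = 0"
      using t a by (simp add: P_def field_simps)
    ultimately show "(g has_real_derivative 0) (at t)"
      by (simp add: algebra_simps)
  qed
  \<comment> \<open>At 0, \<open>u\<close> takes the value \<open>a\<close>, while \<open>v\<close>
    and the first logarithmic factor vanish.\<close>
  also have "g 0 = - Li2 a"
    by (simp add: g_def u_def v_def Li2_0)
  finally show ?thesis
    using a z at[of z] by (simp add: g_def u_def v_def ln_div)
qed

(* For q tending to 1 from below both sides of the q-binomial identity behave like
   exp (c / (1 - q)).  Passing to the limit in the identity means equating the two constants c,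
   which is the Rogers identity with Li2 (a * z) moved to the left and Li2 1 subtracted on both
   sides. *)
theorem theorem1:
  fixes a z :: real
  assumes "a \<in> {0<..<1}" and "z \<in> {0<..<1}"
  shows "(\<forall>q\<in>{0<..<1::real}.
            (\<lambda>n. qexp q (a * q ^ n) / qexp q (q ^ (n + 1)) * z ^ n)
              sums (qexp q a * qexp q z / (qexp q q * qexp q (a * z))))
       \<and> ((\<lambda>q. (1 - q) * ln (\<Sum>n. qexp q (a * q ^ n) / qexp q (q ^ (n + 1)) * z ^ n))
            \<longlongrightarrow> Li2 ((a - a * z) / (1 - a * z)) + Li2 ((z - a * z) / (1 - a * z))
                + ln ((1 - z) / (1 - a * z)) * ln ((1 - a) / (1 - a * z)) - Li2 1) (at_left 1)
       \<and> ((\<lambda>q. (1 - q) * ln (qexp q a * qexp q z / (qexp q q * qexp q (a * z))))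
            \<longlongrightarrow> Li2 a + Li2 z - Li2 (a * z) - Li2 1) (at_left 1)
       \<and> Li2 a + Li2 z
           = Li2 (a * z) + Li2 ((a - a * z) / (1 - a * z)) + Li2 ((z - a * z) / (1 - a * z))
             + ln ((1 - z) / (1 - a * z)) * ln ((1 - a) / (1 - a * z))"
proof -
  have a: "0 < a" "a < 1" and z: "0 < z" "z < 1"
    using assms by auto
  have az: "0 < a * z" "a * z < 1"
    using a z mult_strict_mono[of a 1 z 1] by auto
  let ?S = "\<lambda>q. \<Sum>n. qexp q (a * q ^ n) / qexp q (q ^ (n + 1)) * z ^ n"
  let ?R = "\<lambda>q. qexp q a * qexp q z / (qexp q q * qexp q (a * z))"
  have binomial: "(\<lambda>n. qexp q (a * q ^ n) / qexp q (q ^ (n + 1)) * z ^ n) sums ?R q"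
    if "q \<in> {0<..<1}" for q
    using that a z by (intro q_binomial) auto
  have unit: "eventually (\<lambda>q::real. q \<in> {0<..<1}) (at_left 1)"
    by (rule eventually_at_left_real) simp
  have const: "((\<lambda>q. (1 - q) * ln (qexp q x)) \<longlongrightarrow> Li2 x) (at_left 1)"
    if "0 < x" "x < 1" for x :: real
  proof (rule tendsto_ln_qexp)
    show "eventually (\<lambda>q. 0 \<le> x \<and> x \<le> q) (at_left 1)"
      using eventually_at_left_real[OF that(2)] by eventually_elim (use that in auto)
  qed (use that in auto)
  \<comment> \<open>The factor \<open>qexp q q\<close> has an argument that itself tends to 1; it is
    the source of \<open>Li2 1\<close>.\<close>
  have "((\<lambda>q. (1 - q) * ln (qexp q q)) \<longlongrightarrow> Li2 1) (at_left 1)"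
  proof (rule tendsto_ln_qexp)
    show "eventually (\<lambda>q::real. 0 \<le> q \<and> q \<le> q) (at_left 1)"
      using unit by eventually_elim auto
  qed auto
  then have "((\<lambda>q. (1 - q) * ln (qexp q a) + (1 - q) * ln (qexp q z) - (1 - q) * ln (qexp q (a * z))
      - (1 - q) * ln (qexp q q)) \<longlongrightarrow> Li2 a + Li2 z - Li2 (a * z) - Li2 1) (at_left 1)"
    by (intro tendsto_diff tendsto_add const a z az)
  moreover have "eventually (\<lambda>q. (1 - q) * ln (qexp q a) + (1 - q) * ln (qexp q z)
      - (1 - q) * ln (qexp q (a * z)) - (1 - q) * ln (qexp q q) = (1 - q) * ln (?R q)) (at_left 1)"
    using unit
  proof eventually_elim
    case (elim q)
    then have "qexp q a > 0" "qexp q z > 0" "qexp q q > 0" "qexp q (a * z) > 0"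
      using a z az by (auto intro!: qexp_pos)
    then show ?case
      by (simp add: ln_mult ln_div algebra_simps)
  qed
  ultimately have right: "((\<lambda>q. (1 - q) * ln (?R q))
      \<longlongrightarrow> Li2 a + Li2 z - Li2 (a * z) - Li2 1) (at_left 1)"
    by (rule Lim_transform_eventually)
  \<comment> \<open>The series inherits its limit from the closed form through the binomial
    identity; the pentagonal identity, proved by differentiation, then rewrites that limit.\<close>
  moreover have "eventually (\<lambda>q. (1 - q) * ln (?R q) = (1 - q) * ln (?S q)) (at_left 1)"
    using unit by eventually_elim (use binomial in \<open>simp add: sums_iff\<close>)
  ultimately have left: "((\<lambda>q. (1 - q) * ln (?S q))
      \<longlongrightarrow> Li2 a + Li2 z - Li2 (a * z) - Li2 1) (at_left 1)"
    by (rule Lim_transform_eventually)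
  note pentagonal = Rogers_pentagonal[OF a z]
  then have "Li2 a + Li2 z - Li2 (a * z) - Li2 1
      = Li2 ((a - a * z) / (1 - a * z)) + Li2 ((z - a * z) / (1 - a * z))
        + ln ((1 - z) / (1 - a * z)) * ln ((1 - a) / (1 - a * z)) - Li2 1"
    by simp
  with left right binomial pentagonal show ?thesis
    by (simp only:) blast
qed

end
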